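(* Let $C$ and $K$ be closed convex cones (in finite-dimensional real vector spaces). If $C$ has a proper $K$-lift then $\mathrm{sp}_C(\epsilon)\le\mathrm{sp}_K(\epsilon)$ for all $\epsilon\in(0,1)$.
   Context: Lifts. $C$ has a $K$-lift if there is a linear subspace $L\subseteq\mathrm{span}(K)$ and a linear map $\pi:\mathrm{span}(K)\to\mathrm{span}(C)$ such that $C=\pi(L\cap K)$. If, in addition, $L\cap\mathrm{relint}(K)$ is non-empty, then $C$ has a proper $K$-lift. Sparsification function. For a closed convex cone $K$ and $x,y\in\mathrm{span}(K)$, write $x\preceq_K y$ if $y-x\in K$. A sparsification function for $K$ is a monotonically non-increasing upper semi-continuous function $\alpha:(0,1)\to\mathbb{R}$ such that for any $x_1,\dots,x_m\in K$ with $\sum_{i=1}^m x_i=e\in\mathrm{relint}(K)$ and any $0<\epsilon<1$, there exist $S\subseteq[m]$ with $|S|\le\alpha(\epsilon)$ and positive scalars $(\lambda_i)_{i\in S}$ such that $(1-\epsilon)e\preceq_K\sum_{i\in S}\lambda_i x_i\preceq_K(1+\epsilon)e$. Let $\mathcal{F}_K$ be the collection of all sparsification functions for $K$; the sparsification function of $K$ is $\mathrm{sp}_K(\epsilon)=\inf_{\alpha\in\mathcal{F}_K}\alpha(\epsilon)$, $\epsilon\in(0,1)$. *)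

theory Defs
  imports "HOL-Analysis.Analysis"
begin

definition linear_map_between ::
    "'a::real_vector set \<Rightarrow> 'b::real_vector set \<Rightarrow> ('a \<Rightarrow> 'b) \<Rightarrow> bool" where
  "linear_map_between V W f \<longleftrightarrow>
     f \<in> V \<rightarrow> W \<and>
     (\<forall>x\<in>V. \<forall>y\<in>V. f (x + y) = f x + f y) \<and>
     (\<forall>c. \<forall>x\<in>V. f (c *\<^sub>R x) = c *\<^sub>R f x)"

definition lift_of ::
    "'b::euclidean_space set \<Rightarrow> 'a::euclidean_space set \<Rightarrow> 'a set \<Rightarrow> ('a \<Rightarrow> 'b) \<Rightarrow> bool" where
  "lift_of C K L \<pi> \<longleftrightarrow>
     subspace L \<and> L \<subseteq> span K \<and>
     linear_map_between (span K) (span C) \<pi> \<and> C = \<pi> ` (L \<inter> K)"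

definition has_lift :: "'b::euclidean_space set \<Rightarrow> 'a::euclidean_space set \<Rightarrow> bool" where
  "has_lift C K \<longleftrightarrow> (\<exists>L \<pi>. lift_of C K L \<pi>)"

definition has_proper_lift :: "'b::euclidean_space set \<Rightarrow> 'a::euclidean_space set \<Rightarrow> bool" where
  "has_proper_lift C K \<longleftrightarrow> (\<exists>L \<pi>. lift_of C K L \<pi> \<and> L \<inter> rel_interior K \<noteq> {})"

definition cone_le :: "'a::real_vector set \<Rightarrow> 'a \<Rightarrow> 'a \<Rightarrow> bool" where
  "cone_le K x y \<longleftrightarrow> y - x \<in> K"

definition upper_semicontinuous_on :: "real set \<Rightarrow> (real \<Rightarrow> real) \<Rightarrow> bool" where
  "upper_semicontinuous_on S f \<longleftrightarrow>
     (\<forall>x\<in>S. \<forall>c. f x < c \<longrightarrow> (\<forall>\<^sub>F y in at x within S. f y < c))"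

(* A function on the open unit interval is represented by a total function on the reals of which
   only the restriction to {0<..<1} matters. *)
definition sparsification_function :: "'a::euclidean_space set \<Rightarrow> (real \<Rightarrow> real) \<Rightarrow> bool" where
  "sparsification_function K \<alpha> \<longleftrightarrow>
     antimono_on {0<..<1} \<alpha> \<and> upper_semicontinuous_on {0<..<1} \<alpha> \<and>
     (\<forall>(m::nat) x e \<epsilon>.
        (\<forall>i\<in>{1..m}. x i \<in> K) \<and> (\<Sum>i=1..m. x i) = e \<and> e \<in> rel_interior K \<and> 0 < \<epsilon> \<and> \<epsilon> < 1 \<longrightarrow>
        (\<exists>S\<subseteq>{1..m}. \<exists>c::nat \<Rightarrow> real.
           real (card S) \<le> \<alpha> \<epsilon> \<and> (\<forall>i\<in>S. c i > 0) \<and>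
           cone_le K ((1 - \<epsilon>) *\<^sub>R e) (\<Sum>i\<in>S. c i *\<^sub>R x i) \<and>
           cone_le K (\<Sum>i\<in>S. c i *\<^sub>R x i) ((1 + \<epsilon>) *\<^sub>R e)))"

(* For a convex cone K and 0 < \<epsilon> < 1 the infimum is over a non-empty set of non-negative reals:
   see sparsification_function_DIM and sparsification_function_nonneg. *)
definition sp :: "'a::euclidean_space set \<Rightarrow> real \<Rightarrow> real" where
  "sp K \<epsilon> = (INF \<alpha>\<in>{\<alpha>. sparsification_function K \<alpha>}. \<alpha> \<epsilon>)"

lemma conic_caratheodory:
  fixes x :: "nat \<Rightarrow> 'a::euclidean_space"
  assumes "finite I"
  obtains S c where "S \<subseteq> I" "card S \<le> DIM('a)" "\<forall>i\<in>S. c i > (0::real)"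
    "(\<Sum>i\<in>S. c i *\<^sub>R x i) = (\<Sum>i\<in>I. x i)"
proof -
  define P where "P S \<longleftrightarrow> S \<subseteq> I \<and>
    (\<exists>c. (\<forall>i\<in>S. c i > (0::real)) \<and> (\<Sum>i\<in>S. c i *\<^sub>R x i) = (\<Sum>i\<in>I. x i))" for S
  have "P I" unfolding P_def by (auto intro!: exI[of _ "\<lambda>_. 1"])
  then obtain S where S: "P S" and least: "\<And>T. P T \<Longrightarrow> card S \<le> card T"
    using arg_min_nat_lemma[of P I card] by metis
  from S obtain c where c: "S \<subseteq> I" "\<forall>i\<in>S. c i > 0"
      "(\<Sum>i\<in>S. c i *\<^sub>R x i) = (\<Sum>i\<in>I. x i)"
    unfolding P_def by auto
  have fin: "finite S" using c(1) assms finite_subset by blast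
  have "card S \<le> DIM('a)"
  proof (rule ccontr)
    assume big: "\<not> card S \<le> DIM('a)"
    have "\<exists>u. (\<exists>i\<in>S. u i \<noteq> 0) \<and> (\<Sum>i\<in>S. u i *\<^sub>R x i) = 0"
    proof (cases "inj_on x S")
      case True
      then have "dependent (x ` S)"
        using big fin by (intro dependent_biggerset) (auto simp: card_image)
      then obtain u where "\<exists>v\<in>x ` S. u v \<noteq> 0" "(\<Sum>v\<in>x ` S. u v *\<^sub>R v) = 0"
        using fin by (auto simp: dependent_finite)
      then show ?thesis using True
        by (intro exI[of _ "u \<circ> x"]) (auto simp: sum.reindex)
    next
      case False
      then obtain i j where ij: "i \<in> S" "j \<in> S" "i \<noteq> j" "x i = x j"
        unfolding inj_on_def by blast
      define u where "u k = (if k = i then 1 else if k = j then -1 else (0::real))" for k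
      have "(\<Sum>k\<in>S. u k *\<^sub>R x k) = (\<Sum>k\<in>{i,j}. u k *\<^sub>R x k)"
        using ij fin by (intro sum.mono_neutral_right) (auto simp: u_def)
      also have "\<dots> = 0" using ij by (simp add: u_def)
      finally show ?thesis using ij by (intro exI[of _ u]) (auto simp: u_def)
    qed
    then obtain u where u: "\<exists>i\<in>S. u i \<noteq> 0" "(\<Sum>i\<in>S. u i *\<^sub>R x i) = 0" by blast
    obtain w where w: "\<exists>i\<in>S. w i > 0" "(\<Sum>i\<in>S. w i *\<^sub>R x i) = 0"
    proof (cases "\<exists>i\<in>S. u i > 0")
      case True then show ?thesis using u(2) that by blast
    next
      case False
      then have "\<exists>i\<in>S. - u i > 0" using u(1) by force
      moreover have "(\<Sum>i\<in>S. (- u i) *\<^sub>R x i) = 0" using u(2) by (simp add: sum_negf)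
      ultimately show ?thesis by (rule that)
    qed
    define J where "J = {i\<in>S. w i > 0}"
    have J: "finite J" "J \<noteq> {}" using fin w(1) unfolding J_def by auto
    obtain k where k: "k \<in> J" and kmin: "\<And>i. i \<in> J \<Longrightarrow> c k / w k \<le> c i / w i"
      using ex_is_arg_min_if_finite[OF J, of "\<lambda>i. c i / w i"]
      by (auto simp: is_arg_min_linorder)
    define t where "t = c k / w k"
    define d where "d i = c i - t * w i" for i
    have t: "t > 0" using k c(2) unfolding t_def J_def by auto
    have d: "d i \<ge> 0" if "i \<in> S" for i
    proof (cases "w i > 0")
      case True
      then have "t \<le> c i / w i" using kmin that unfolding t_def J_def by auto
      then show ?thesis using True unfolding d_def by (simp add: field_simps)
    next
      case False
      then have "t * w i \<le> 0" using t by (simp add: mult_le_0_iff)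
      then show ?thesis using c(2) that unfolding d_def by force
    qed
    have dk: "d k = 0" using k unfolding d_def t_def J_def by auto
    define T where "T = {i\<in>S. d i > 0}"
    have "(\<Sum>i\<in>T. d i *\<^sub>R x i) = (\<Sum>i\<in>S. d i *\<^sub>R x i)"
      using fin d by (intro sum.mono_neutral_left) (force simp: T_def)+
    also have "\<dots> = (\<Sum>i\<in>S. c i *\<^sub>R x i) - t *\<^sub>R (\<Sum>i\<in>S. w i *\<^sub>R x i)"
      by (simp add: d_def scaleR_diff_left sum_subtractf scaleR_sum_right)
    finally have "P T" using c w unfolding P_def T_def by auto
    moreover have "T \<subset> S"
    proof
      show "T \<subseteq> S" unfolding T_def by auto
      have "k \<in> S" "k \<notin> T" using k dk unfolding T_def J_def by auto
      then show "T \<noteq> S" by blast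
    qed
    ultimately show False using least[of T] psubset_card_mono[OF fin, of T] by linarith
  qed
  then show ?thesis by (rule that[OF c(1) _ c(2,3)])
qed

lemma sparsification_function_DIM:
  fixes K :: "'a::euclidean_space set"
  assumes "convex_cone K"
  shows "sparsification_function K (\<lambda>_. real DIM('a))"
  unfolding sparsification_function_def
proof (intro conjI allI impI)
  show "antimono_on {0<..<1} (\<lambda>_::real. real DIM('a))" by (simp add: monotone_on_def)
  show "upper_semicontinuous_on {0<..<1} (\<lambda>_. real DIM('a))"
    by (simp add: upper_semicontinuous_on_def)
  fix m :: nat and x :: "nat \<Rightarrow> 'a" and e and \<epsilon> :: real
  assume H: "(\<forall>i\<in>{1..m}. x i \<in> K) \<and> (\<Sum>i=1..m. x i) = e \<and> e \<in> rel_interior K \<and> 0 < \<epsilon> \<and> \<epsilon> < 1"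
  then have e: "e \<in> K" using rel_interior_subset by blast
  obtain S c where S: "S \<subseteq> {1..m}" "card S \<le> DIM('a)" "\<forall>i\<in>S. c i > (0::real)"
    "(\<Sum>i\<in>S. c i *\<^sub>R x i) = (\<Sum>i=1..m. x i)"
    using conic_caratheodory[of "{1..m}" x] by auto
  have "\<epsilon> *\<^sub>R e \<in> K" using H e assms unfolding convex_cone_def conic_def by auto
  then have "cone_le K ((1 - \<epsilon>) *\<^sub>R e) e" "cone_le K e ((1 + \<epsilon>) *\<^sub>R e)"
    unfolding cone_le_def by (simp_all add: algebra_simps)
  moreover have "(\<Sum>i\<in>S. c i *\<^sub>R x i) = e" using S(4) H by simp
  ultimately show "\<exists>S\<subseteq>{1..m}. \<exists>c::nat \<Rightarrow> real.
      real (card S) \<le> real DIM('a) \<and> (\<forall>i\<in>S. c i > 0) \<and>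
      cone_le K ((1 - \<epsilon>) *\<^sub>R e) (\<Sum>i\<in>S. c i *\<^sub>R x i) \<and>
      cone_le K (\<Sum>i\<in>S. c i *\<^sub>R x i) ((1 + \<epsilon>) *\<^sub>R e)"
    using S(1,2,3) by (intro exI[of _ S] conjI[OF S(1)] exI[of _ c]) simp
qed

lemma sparsification_function_nonneg:
  fixes K :: "'a::euclidean_space set"
  assumes "convex_cone K" "sparsification_function K \<alpha>" "0 < \<epsilon>" "\<epsilon> < 1"
  shows "0 \<le> \<alpha> \<epsilon>"
proof -
  obtain e where e: "e \<in> rel_interior K"
    using assms(1) rel_interior_eq_empty unfolding convex_cone_def by blast
  then have "e \<in> K" using rel_interior_subset by blast
  have "(\<forall>i\<in>{1..1::nat}. e \<in> K) \<and> (\<Sum>i=1..1::nat. e) = e \<and> e \<in> rel_interior K \<and> 0 < \<epsilon> \<and> \<epsilon> < 1"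
    using e \<open>e \<in> K\<close> assms(3,4) by simp
  then obtain S :: "nat set" where "real (card S) \<le> \<alpha> \<epsilon>"
    using assms(2) unfolding sparsification_function_def by metis
  then show ?thesis using of_nat_0_le_iff[of "card S", where 'a=real] by linarith
qed

end

theory Submission
  imports Defs
begin

text \<open>
  Every sparsification function of \<open>K\<close> is one of \<open>C\<close>.  Lift the \<open>x\<^sub>i\<close> to points \<open>y\<^sub>i\<close> of
  \<open>L \<inter> K\<close>.  Their sum may lie on the relative boundary of \<open>K\<close>, so add \<open>\<delta> g\<close>, with \<open>g\<close> in
  \<open>L \<inter> relint K\<close>, to some of the \<open>y\<^sub>i\<close>, sparsify with a slightly smaller error \<open>\<eta> < \<epsilon>\<close> and
  project.  If only the \<open>y\<^sub>i\<close> with \<open>- x\<^sub>i \<notin> C\<close> are perturbed, the coefficients of the perturbed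
  vectors are bounded independently of \<open>\<delta>\<close>; as \<open>\<pi> g\<close> is at most a multiple of \<open>e\<close>, which lies in
  the relative interior of \<open>C\<close>, a small \<open>\<delta>\<close> costs at most \<open>\<epsilon> - \<eta>\<close>.  Cardinalities being integers,
  semicontinuity lets \<open>\<eta>\<close> be chosen so that \<open>\<alpha> \<eta>\<close> allows no larger subset than \<open>\<alpha> \<epsilon>\<close>.
\<close>

section \<open>Linear maps given only on a span\<close>

lemma linear_map_between_diff:
  assumes "linear_map_between (span K) W f" "x \<in> span K" "y \<in> span K"
  shows "f (x - y) = f x - f y"
proof -
  have "f (x + (-1) *\<^sub>R y) = f x + (-1) *\<^sub>R f y"
    using assms span_scale[OF assms(3), of "-1"] unfolding linear_map_between_def by metis
  then show ?thesis by simp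
qed

lemma linear_map_between_sum:
  assumes "linear_map_between (span K) W f" "finite I" "\<And>i. i \<in> I \<Longrightarrow> x i \<in> span K"
  shows "f (\<Sum>i\<in>I. c i *\<^sub>R x i) = (\<Sum>i\<in>I. c i *\<^sub>R f (x i))"
  using assms(2,3)
proof (induction I rule: finite_induct)
  case empty
  have "f (0 *\<^sub>R 0) = 0 *\<^sub>R f 0"
    using assms(1) span_0 unfolding linear_map_between_def by metis
  then show ?case by simp
next
  case (insert i I)
  have "(\<Sum>j\<in>I. c j *\<^sub>R x j) \<in> span K"
    using insert by (intro span_sum span_scale) auto
  moreover have "x i \<in> span K" using insert by auto
  ultimately have "f (c i *\<^sub>R x i + (\<Sum>j\<in>I. c j *\<^sub>R x j)) = c i *\<^sub>R f (x i) + f (\<Sum>j\<in>I. c j *\<^sub>R x j)"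
    using assms(1) span_scale[of "x i" K "c i"] unfolding linear_map_between_def by metis
  then show ?case using insert by simp
qed

section \<open>Convex cones and their relative interiors\<close>

lemma convex_cone_sum_mem:
  assumes "convex_cone C" "\<And>i. i \<in> I \<Longrightarrow> x i \<in> C"
  shows "sum x I \<in> C"
  using assms
  by (induction I rule: infinite_finite_induct)
     (auto simp: convex_cone_contains_0 convex_cone_add)

text \<open>A point is relatively interior iff every segment of \<open>K\<close> ending there can be
  prolonged. Prolong the one from \<open>x / t\<close> past \<open>g\<close>, rescale by
  \<open>t\<close> and add \<open>\<mu> *\<^sub>R f\<close>.\<close>

lemma rel_interior_convex_cone_add:
  fixes K :: "'a::euclidean_space set"
  assumes "convex_cone K" "f \<in> K" "g \<in> rel_interior K" "t > 0"
  shows "f + t *\<^sub>R g \<in> rel_interior K"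
proof -
  have conv: "convex K" and con: "\<And>x c. x \<in> K \<Longrightarrow> 0 \<le> c \<Longrightarrow> c *\<^sub>R x \<in> K"
    using assms(1) by (auto simp: convex_cone_def conic_def)
  have "\<exists>\<mu>>1. (1 - \<mu>) *\<^sub>R x + \<mu> *\<^sub>R (f + t *\<^sub>R g) \<in> K" if x: "x \<in> K" for x
  proof -
    have "(1/t) *\<^sub>R x \<in> K" using con[OF x] assms(4) by simp
    then obtain \<mu> where \<mu>: "\<mu> > 1" "(1 - \<mu>) *\<^sub>R (1/t) *\<^sub>R x + \<mu> *\<^sub>R g \<in> K"
      using assms(3) convex_rel_interior_iff[OF conv, of g] assms(1)
      unfolding convex_cone_def by blast
    have "t *\<^sub>R ((1 - \<mu>) *\<^sub>R (1/t) *\<^sub>R x + \<mu> *\<^sub>R g) + \<mu> *\<^sub>R f \<in> K"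
      using \<mu> con assms by (intro convex_cone_add[OF assms(1)]) auto
    moreover have "t *\<^sub>R (1 - \<mu>) *\<^sub>R (1/t) *\<^sub>R x = (1 - \<mu>) *\<^sub>R x" using assms(4) by simp
    ultimately show ?thesis
      using \<mu>(1) assms(4) by (intro exI[of _ \<mu>]) (simp add: scaleR_add_right add_ac mult.commute)
  qed
  then show ?thesis
    using convex_rel_interior_iff[OF conv] assms(1) unfolding convex_cone_def by blast
qed

text \<open>Prolong the segment from \<open>p\<close> slightly beyond \<open>e\<close> inside
  \<open>C\<close>, then divide by \<open>\<mu> - 1\<close> to give \<open>p\<close> the coefficient
  -1.\<close>

lemma rel_interior_convex_cone_dominates:
  fixes C :: "'a::euclidean_space set"
  assumes "convex_cone C" "e \<in> rel_interior C" "p \<in> C"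
  obtains R where "R > 0" "cone_le C p (R *\<^sub>R e)"
proof -
  have "convex C" "C \<noteq> {}" using assms(1) by (auto simp: convex_cone_def)
  then obtain \<mu> where \<mu>: "\<mu> > 1" "(1 - \<mu>) *\<^sub>R p + \<mu> *\<^sub>R e \<in> C"
    using assms(2,3) convex_rel_interior_iff by blast
  have "(1 / (\<mu> - 1)) *\<^sub>R ((1 - \<mu>) *\<^sub>R p + \<mu> *\<^sub>R e) \<in> C"
    using \<mu> assms(1) by (intro convex_cone_scaleR) auto
  moreover have "(1 / (\<mu> - 1)) *\<^sub>R ((1 - \<mu>) *\<^sub>R p + \<mu> *\<^sub>R e) = (\<mu> / (\<mu> - 1)) *\<^sub>R e - p"
  proof -
    have "(1 / (\<mu> - 1)) * (1 - \<mu>) = -1" using \<mu>(1) by (simp add: field_simps)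
    then show ?thesis by (simp add: scaleR_add_right)
  qed
  ultimately show ?thesis using \<mu>(1) by (intro that[of "\<mu> / (\<mu> - 1)"]) (auto simp: cone_le_def)
qed

text \<open>Dividing by \<open>c\<close> puts \<open>e / c - x\<close> in \<open>C\<close>. For
  unbounded \<open>c\<close> these points would tend to \<open>- x\<close>, which has a whole
  neighbourhood outside the closed set \<open>C\<close>.\<close>

lemma closed_cone_bounded_multiples:
  fixes C :: "'a::real_normed_vector set"
  assumes "closed C" "convex_cone C" "- x \<notin> C"
  obtains B where "\<And>c. 0 < c \<Longrightarrow> cone_le C (c *\<^sub>R x) e \<Longrightarrow> c \<le> B"
proof -
  have "((\<lambda>s. s *\<^sub>R e - x) \<longlongrightarrow> 0 *\<^sub>R e - x) (at_right (0::real))"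
    by (intro tendsto_intros)
  moreover have "0 *\<^sub>R e - x \<in> - C" "open (- C)" using assms by auto
  ultimately have "\<forall>\<^sub>F s in at_right (0::real). s *\<^sub>R e - x \<in> - C"
    using topological_tendstoD by blast
  then obtain r where r: "r > 0" "\<And>s. 0 < s \<Longrightarrow> s < r \<Longrightarrow> s *\<^sub>R e - x \<notin> C"
    unfolding eventually_at_right_field by auto
  show ?thesis
  proof (rule that[of "1 / r"], rule ccontr)
    fix c assume c: "0 < c" "cone_le C (c *\<^sub>R x) e" "\<not> c \<le> 1 / r"
    have "(1 / c) *\<^sub>R (e - c *\<^sub>R x) \<in> C"
      using c assms(2) by (intro convex_cone_scaleR) (auto simp: cone_le_def)
    then have "(1 / c) *\<^sub>R e - x \<in> C" using c(1) by (simp add: scaleR_diff_right)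
    moreover have "1 / c < r" using c(1,3) r(1) by (simp add: field_simps)
    ultimately show False using r(2)[of "1 / c"] c(1) by simp
  qed
qed

section \<open>Semicontinuity and integer cardinalities\<close>

lemma upper_semicontinuous_on_nat_bound:
  assumes "upper_semicontinuous_on {0<..<1} \<alpha>" "0 < \<epsilon>" "\<epsilon> < 1"
  obtains \<eta> where "0 < \<eta>" "\<eta> < \<epsilon>" "\<And>n::nat. real n \<le> \<alpha> \<eta> \<Longrightarrow> real n \<le> \<alpha> \<epsilon>"
proof -
  \<comment> \<open>The threshold is the least integer above \<open>\<alpha> \<epsilon>\<close>: a
    natural number below it is at most \<open>\<alpha> \<epsilon>\<close>.\<close>
  have "\<forall>\<^sub>F y in at \<epsilon> within {0<..<1}. \<alpha> y < of_int \<lfloor>\<alpha> \<epsilon>\<rfloor> + 1"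
    using assms unfolding upper_semicontinuous_on_def by auto
  then have "\<forall>\<^sub>F y in at \<epsilon>. \<alpha> y < of_int \<lfloor>\<alpha> \<epsilon>\<rfloor> + 1"
    using at_within_open[of \<epsilon> "{0<..<1}"] assms(2,3) by simp
  then have "\<forall>\<^sub>F y in at_left \<epsilon>. \<alpha> y < of_int \<lfloor>\<alpha> \<epsilon>\<rfloor> + 1"
    using eventually_at_split by blast
  then obtain b where b: "b < \<epsilon>" "\<And>y. b < y \<Longrightarrow> y < \<epsilon> \<Longrightarrow> \<alpha> y < of_int \<lfloor>\<alpha> \<epsilon>\<rfloor> + 1"
    unfolding eventually_at_left_field by auto
  obtain \<eta> where \<eta>: "max 0 b < \<eta>" "\<eta> < \<epsilon>" using dense[of "max 0 b" \<epsilon>] b(1) assms(2) by auto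
  show ?thesis
  proof (rule that[of \<eta>])
    fix n :: nat assume "real n \<le> \<alpha> \<eta>"
    then have "real n < of_int \<lfloor>\<alpha> \<epsilon>\<rfloor> + 1" using b(2)[of \<eta>] \<eta> by auto
    then have "int n \<le> \<lfloor>\<alpha> \<epsilon>\<rfloor>" by linarith
    then show "real n \<le> \<alpha> \<epsilon>" by linarith
  qed (use \<eta> in auto)
qed

section \<open>Transfer along a proper lift and comparison of the infima\<close>

lemma sparsification_function_proper_lift:
  fixes C :: "'b::euclidean_space set" and K :: "'a::euclidean_space set"
  assumes "closed C" "convex_cone C" "convex_cone K" "has_proper_lift C K"
    and sf: "sparsification_function K \<alpha>"
  shows "sparsification_function C \<alpha>"
  unfolding sparsification_function_def
proof (intro conjI allI impI)
  show "antimono_on {0<..<1} \<alpha>" and usc: "upper_semicontinuous_on {0<..<1} \<alpha>"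
    using sf unfolding sparsification_function_def by auto
  fix m :: nat and x :: "nat \<Rightarrow> 'b" and e and \<epsilon> :: real
  assume H: "(\<forall>i\<in>{1..m}. x i \<in> C) \<and> (\<Sum>i=1..m. x i) = e \<and> e \<in> rel_interior C \<and> 0 < \<epsilon> \<and> \<epsilon> < 1"
  then have xC: "\<And>i. i \<in> {1..m} \<Longrightarrow> x i \<in> C" and sumx: "(\<Sum>i=1..m. x i) = e"
    and eint: "e \<in> rel_interior C" and \<epsilon>: "0 < \<epsilon>" "\<epsilon> < 1" by auto
  note add = convex_cone_add[OF assms(2)] and scale = convex_cone_scaleR[OF assms(2)]
  have e: "e \<in> C" using eint rel_interior_subset by blast
  obtain L \<pi> g where L: "subspace L" and LK: "L \<subseteq> span K"
    and \<pi>: "linear_map_between (span K) (span C) \<pi>" and C: "C = \<pi> ` (L \<inter> K)"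
    and g: "g \<in> L" "g \<in> rel_interior K"
    using assms(4) unfolding has_proper_lift_def lift_of_def by blast
  have gK: "g \<in> K" using g rel_interior_subset by blast
  define p where "p = \<pi> g"
  have p: "p \<in> C" using C g gK p_def by blast
  obtain R where R: "R > 0" "cone_le C p (R *\<^sub>R e)"
    using rel_interior_convex_cone_dominates[OF assms(2) eint p] by blast
  have "\<exists>y. y \<in> L \<inter> K \<and> \<pi> y = q" if "q \<in> C" for q
    using that unfolding C by blast
  moreover have "\<forall>i\<in>{1..m}. x i \<in> C" using xC by blast
  ultimately have "\<forall>i\<in>{1..m}. \<exists>y. y \<in> L \<inter> K \<and> \<pi> y = x i" by simp
  then obtain y where "\<forall>i\<in>{1..m}. y i \<in> L \<inter> K \<and> \<pi> (y i) = x i" by (rule bchoice[THEN exE])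
  then have y: "\<And>i. i \<in> {1..m} \<Longrightarrow> y i \<in> L" "\<And>i. i \<in> {1..m} \<Longrightarrow> y i \<in> K"
    "\<And>i. i \<in> {1..m} \<Longrightarrow> \<pi> (y i) = x i" by auto
  define I where "I = {i\<in>{1..m}. - x i \<notin> C}"
  have finI: "finite I" unfolding I_def by auto
  \<comment> \<open>The bound \<open>2 *\<^sub>R e\<close> dominates
    \<open>(1 + \<epsilon>) *\<^sub>R e\<close> and involves neither \<delta> nor the coefficients
    still to be found, so \<delta> may depend on \<open>B\<close>.\<close>
  have "\<exists>B. \<forall>c>0. cone_le C (c *\<^sub>R x i) (2 *\<^sub>R e) \<longrightarrow> c \<le> B" if "i \<in> I" for i
  proof -
    have "- x i \<notin> C" using that unfolding I_def by simp
    then obtain B where "\<And>c. 0 < c \<Longrightarrow> cone_le C (c *\<^sub>R x i) (2 *\<^sub>R e) \<Longrightarrow> c \<le> B"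
      using closed_cone_bounded_multiples[OF assms(1,2)] by blast
    then show ?thesis by blast
  qed
  then obtain B0 where B0: "\<And>i c. i \<in> I \<Longrightarrow> 0 < c \<Longrightarrow> cone_le C (c *\<^sub>R x i) (2 *\<^sub>R e) \<Longrightarrow> c \<le> B0 i"
    by metis
  define B where "B = (\<Sum>i\<in>I. \<bar>B0 i\<bar>)"
  have B: "B \<ge> 0" unfolding B_def by (simp add: sum_nonneg)
  obtain \<eta> where \<eta>: "0 < \<eta>" "\<eta> < \<epsilon>" "\<And>n::nat. real n \<le> \<alpha> \<eta> \<Longrightarrow> real n \<le> \<alpha> \<epsilon>"
    using upper_semicontinuous_on_nat_bound[OF usc \<epsilon>] by blast
  show "\<exists>S\<subseteq>{1..m}. \<exists>c::nat \<Rightarrow> real.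
      real (card S) \<le> \<alpha> \<epsilon> \<and> (\<forall>i\<in>S. c i > 0) \<and>
      cone_le C ((1 - \<epsilon>) *\<^sub>R e) (\<Sum>i\<in>S. c i *\<^sub>R x i) \<and>
      cone_le C (\<Sum>i\<in>S. c i *\<^sub>R x i) ((1 + \<epsilon>) *\<^sub>R e)"
  proof (cases "I = {}")
    \<comment> \<open>With nothing to perturb, both \<open>e\<close> and \<open>- e\<close> lie in
      \<open>C\<close>, so the empty sum already approximates \<open>e\<close>.\<close>
    case True
    then have "(\<Sum>i=1..m. - x i) \<in> C"
      unfolding I_def by (intro convex_cone_sum_mem[OF assms(2)]) auto
    then have "- e \<in> C" using sumx by (simp add: sum_negf)
    then have "(1 - \<epsilon>) *\<^sub>R (- e) \<in> C" "(1 + \<epsilon>) *\<^sub>R e \<in> C"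
      using \<epsilon> e by (intro scale; simp)+
    moreover have "0 \<le> \<alpha> \<epsilon>" using sparsification_function_nonneg[OF assms(3) sf \<epsilon>] .
    ultimately show ?thesis by (intro exI[of _ "{}"]) (simp add: cone_le_def)
  next
    case False
    define k where "k = real (card I)"
    have k: "k > 0" using False finI unfolding k_def by (simp add: card_gt_0_iff)
    \<comment> \<open>This makes \<open>2 * \<delta> * k * R + \<delta> * B * R\<close> equal to
      \<open>\<epsilon> - \<eta>\<close>. The first term pays for the surplus
      \<open>(\<delta> * k) *\<^sub>R p\<close> in the projection of \<open>f\<close>, the second
      for the perturbation \<open>T *\<^sub>R p\<close> of the projected sparse sum.\<close>
    define \<delta> where "\<delta> = (\<epsilon> - \<eta>) / (R * (2 * k + B))"
    have den: "R * (2 * k + B) > 0" using R k B by (simp add: add_pos_nonneg)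
    have \<delta>: "\<delta> > 0" using \<eta> den unfolding \<delta>_def by simp
    have "\<delta> * (R * (2 * k + B)) = \<epsilon> - \<eta>"
      using den \<delta>_def by (metis nonzero_eq_divide_eq less_irrefl)
    then have \<delta>eq: "2 * (\<delta> * k * R) + \<delta> * B * R = \<epsilon> - \<eta>" by (simp add: algebra_simps)
    have \<delta>nn: "\<delta> * k * R \<ge> 0" "\<delta> * B * R \<ge> 0" using \<delta> k B R by auto
    define t where "t i = (if i \<in> I then \<delta> else 0)" for i
    define z where "z i = y i + t i *\<^sub>R g" for i
    have tnn: "t i \<ge> 0" for i using \<delta> unfolding t_def by simp
    have zL: "z i \<in> L" if "i \<in> {1..m}" for i
      unfolding z_def using y(1)[OF that] g(1) L by (intro subspace_add subspace_scale)
    have zK: "z i \<in> K" if "i \<in> {1..m}" for i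
      unfolding z_def using y(2)[OF that] gK tnn
      by (intro convex_cone_add[OF assms(3)] convex_cone_scaleR[OF assms(3)])
    have \<pi>z: "\<pi> (z i) = x i + t i *\<^sub>R p" if "i \<in> {1..m}" for i
    proof -
      have "y i \<in> span K" "g \<in> span K" using y that g LK by auto
      then have "\<pi> (y i + t i *\<^sub>R g) = \<pi> (y i) + t i *\<^sub>R \<pi> g"
        using \<pi> span_scale[of g K "t i"] unfolding linear_map_between_def by metis
      then show ?thesis using y that unfolding z_def p_def by simp
    qed
    have sumt: "(\<Sum>i=1..m. t i) = \<delta> * k"
    proof -
      have "(\<Sum>i=1..m. t i) = (\<Sum>i\<in>I. t i)"
        by (intro sum.mono_neutral_right) (auto simp: I_def t_def)
      also have "\<dots> = \<delta> * k" unfolding t_def k_def by simp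
      finally show ?thesis .
    qed
    define f where "f = (\<Sum>i=1..m. z i)"
    have "f = (\<Sum>i=1..m. y i) + (\<delta> * k) *\<^sub>R g"
      unfolding f_def z_def sumt[symmetric] by (simp add: sum.distrib scaleR_left.sum)
    moreover have "(\<Sum>i=1..m. y i) \<in> K" using y by (intro convex_cone_sum_mem[OF assms(3)])
    ultimately have fint: "f \<in> rel_interior K"
      using rel_interior_convex_cone_add[OF assms(3) _ g(2)] \<delta> k by simp
    have fL: "f \<in> L" using zL L unfolding f_def by (intro subspace_sum)
    have \<pi>f: "\<pi> f = e + (\<delta> * k) *\<^sub>R p"
    proof -
      have "\<pi> (\<Sum>i=1..m. 1 *\<^sub>R z i) = (\<Sum>i=1..m. 1 *\<^sub>R \<pi> (z i))"
        using zL LK by (intro linear_map_between_sum[OF \<pi>]) auto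
      also have "\<dots> = (\<Sum>i=1..m. x i + t i *\<^sub>R p)" using \<pi>z by simp
      also have "\<dots> = e + (\<delta> * k) *\<^sub>R p"
        unfolding sumt[symmetric] using sumx by (simp add: sum.distrib scaleR_left.sum)
      finally show ?thesis unfolding f_def by simp
    qed
    have "\<exists>S\<subseteq>{1..m}. \<exists>c::nat \<Rightarrow> real.
      real (card S) \<le> \<alpha> \<eta> \<and> (\<forall>i\<in>S. c i > 0) \<and>
      cone_le K ((1 - \<eta>) *\<^sub>R f) (\<Sum>i\<in>S. c i *\<^sub>R z i) \<and>
      cone_le K (\<Sum>i\<in>S. c i *\<^sub>R z i) ((1 + \<eta>) *\<^sub>R f)"
      using sf zK fint \<eta> \<epsilon> unfolding sparsification_function_def f_def by auto
    then obtain S c where S: "S \<subseteq> {1..m}" "real (card S) \<le> \<alpha> \<eta>" "\<And>i. i \<in> S \<Longrightarrow> c i > (0::real)"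
      "cone_le K ((1 - \<eta>) *\<^sub>R f) (\<Sum>i\<in>S. c i *\<^sub>R z i)"
      "cone_le K (\<Sum>i\<in>S. c i *\<^sub>R z i) ((1 + \<eta>) *\<^sub>R f)" by blast
    have Sm: "i \<in> {1..m}" if "i \<in> S" for i using S(1) that by blast
    have finS: "finite S" using S(1) finite_subset by blast
    \<comment> \<open>Differences must stay in \<open>L\<close>, since only
      \<open>L \<inter> K\<close> is known to be mapped into \<open>C\<close>.\<close>
    have le: "cone_le C (\<pi> u) (\<pi> v)" if "u \<in> L" "v \<in> L" "cone_le K u v" for u v
    proof -
      have "v - u \<in> L \<inter> K" using that L unfolding cone_le_def by (auto intro: subspace_diff)
      moreover have "\<pi> (v - u) = \<pi> v - \<pi> u"
        using that LK by (intro linear_map_between_diff[OF \<pi>]) auto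
      ultimately show ?thesis unfolding cone_le_def C by (metis imageI)
    qed
    define T where "T = (\<Sum>i\<in>S. c i * t i)"
    define s where "s = (\<Sum>i\<in>S. c i *\<^sub>R x i)"
    have \<pi>f_scale: "\<pi> (a *\<^sub>R f) = a *\<^sub>R (e + (\<delta> * k) *\<^sub>R p)" for a
      using \<pi> fL LK \<pi>f unfolding linear_map_between_def by (metis subsetD)
    have \<pi>s: "\<pi> (\<Sum>i\<in>S. c i *\<^sub>R z i) = s + T *\<^sub>R p"
    proof -
      have "\<pi> (\<Sum>i\<in>S. c i *\<^sub>R z i) = (\<Sum>i\<in>S. c i *\<^sub>R \<pi> (z i))"
        using zL[OF Sm] LK by (intro linear_map_between_sum[OF \<pi> finS]) blast
      also have "\<dots> = (\<Sum>i\<in>S. c i *\<^sub>R (x i + t i *\<^sub>R p))"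
        using \<pi>z[OF Sm] by (intro sum.cong) auto
      also have "\<dots> = s + T *\<^sub>R p"
        unfolding s_def T_def by (simp add: sum.distrib scaleR_add_right scaleR_left.sum)
      finally show ?thesis .
    qed
    have zsL: "(\<Sum>i\<in>S. c i *\<^sub>R z i) \<in> L" using zL[OF Sm] L by (intro subspace_sum subspace_scale)
    have fsL: "a *\<^sub>R f \<in> L" for a using fL L by (simp add: subspace_scale)
    have lower: "s + T *\<^sub>R p - (1 - \<eta>) *\<^sub>R (e + (\<delta> * k) *\<^sub>R p) \<in> C"
      using le[OF fsL zsL S(4)] unfolding \<pi>s \<pi>f_scale cone_le_def .
    have upper: "(1 + \<eta>) *\<^sub>R (e + (\<delta> * k) *\<^sub>R p) - (s + T *\<^sub>R p) \<in> C"
      using le[OF zsL fsL S(5)] unfolding \<pi>s \<pi>f_scale cone_le_def .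
    have T0: "T \<ge> 0" unfolding T_def using S(3) tnn by (force intro!: sum_nonneg)
    have Rp: "R *\<^sub>R e - p \<in> C" using R unfolding cone_le_def by simp
    \<comment> \<open>The upper estimate needs no bound on \<open>T\<close>, because
      \<open>T *\<^sub>R p\<close> lies in \<open>C\<close> and can be discarded. It therefore comes
      first and serves to bound \<open>T\<close>.\<close>
    have su: "(1 + \<epsilon>) *\<^sub>R e - s \<in> C"
    proof -
      define a where "a = (1 + \<eta>) * (\<delta> * k)"
      have "a * R = (1 + \<eta>) * (\<delta> * k * R)" unfolding a_def by simp
      also have "\<dots> \<le> 2 * (\<delta> * k * R)" using \<eta> \<epsilon> \<delta>nn by (intro mult_right_mono) auto
      finally have aR: "a * R \<le> \<epsilon> - \<eta>" using \<delta>eq \<delta>nn by linarith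
      have "a \<ge> 0" unfolding a_def using \<eta> \<delta> k by simp
      then have "((1 + \<eta>) *\<^sub>R (e + (\<delta> * k) *\<^sub>R p) - (s + T *\<^sub>R p)) + T *\<^sub>R p + a *\<^sub>R (R *\<^sub>R e - p)
          + (\<epsilon> - \<eta> - a * R) *\<^sub>R e \<in> C"
        using upper T0 p Rp e aR by (intro add scale) auto
      then show ?thesis unfolding a_def by (simp add: algebra_simps)
    qed
    have TB: "T \<le> \<delta> * B"
    proof -
      \<comment> \<open>The other summands of \<open>s\<close> lie in \<open>C\<close>, so
        \<open>c i *\<^sub>R x i\<close> is below \<open>s\<close>, hence below
        \<open>(1 + \<epsilon>) *\<^sub>R e\<close> and \<open>2 *\<^sub>R e\<close>.\<close>
      have cB: "c i \<le> \<bar>B0 i\<bar>" if i: "i \<in> S \<inter> I" for i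
      proof -
        have "(\<Sum>j\<in>S - {i}. c j *\<^sub>R x j) \<in> C"
          using S(3) xC[OF Sm] by (intro convex_cone_sum_mem[OF assms(2)] scale) (auto intro: less_imp_le)
        moreover have "s = c i *\<^sub>R x i + (\<Sum>j\<in>S - {i}. c j *\<^sub>R x j)"
          unfolding s_def using i finS by (intro sum.remove) auto
        moreover have "(1 - \<epsilon>) *\<^sub>R e \<in> C" using \<epsilon> e by (intro scale) auto
        ultimately have "((1 + \<epsilon>) *\<^sub>R e - s) + (s - c i *\<^sub>R x i) + (1 - \<epsilon>) *\<^sub>R e \<in> C"
          using su by (intro add) auto
        moreover have "((1 + \<epsilon>) *\<^sub>R e - s) + (s - c i *\<^sub>R x i) + (1 - \<epsilon>) *\<^sub>R e = 2 *\<^sub>R e - c i *\<^sub>R x i"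
          by (simp add: algebra_simps scaleR_2)
        ultimately have "cone_le C (c i *\<^sub>R x i) (2 *\<^sub>R e)" unfolding cone_le_def by metis
        then show ?thesis using B0[of i "c i"] S(3) i by auto
      qed
      have "T = (\<Sum>i\<in>S \<inter> I. c i * \<delta>)"
        unfolding T_def t_def using finS by (simp add: sum.inter_restrict if_distrib cong: if_cong)
      also have "\<dots> \<le> (\<Sum>i\<in>S \<inter> I. \<bar>B0 i\<bar> * \<delta>)"
        using cB \<delta> by (intro sum_mono mult_right_mono) auto
      also have "\<dots> \<le> (\<Sum>i\<in>I. \<bar>B0 i\<bar> * \<delta>)"
        using finI \<delta> by (intro sum_mono2) auto
      also have "\<dots> = \<delta> * B" unfolding B_def by (simp add: sum_distrib_left mult.commute)
      finally show ?thesis .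
    qed
    have "s - (1 - \<epsilon>) *\<^sub>R e \<in> C"
    proof -
      have "T * R \<le> \<delta> * B * R" using TB R by (intro mult_right_mono) auto
      then have TR: "T * R \<le> \<epsilon> - \<eta>" using \<delta>eq \<delta>nn by linarith
      \<comment> \<open>Here the surplus in \<open>f\<close> is harmless: its multiple of
        \<open>p\<close> is nonnegative and is added back. Only \<open>T *\<^sub>R p\<close> costs
        something, at most \<open>(T * R) *\<^sub>R e\<close>. All terms in \<open>p\<close>
        cancel.\<close>
      have "(s + T *\<^sub>R p - (1 - \<eta>) *\<^sub>R (e + (\<delta> * k) *\<^sub>R p)) + ((1 - \<eta>) * (\<delta> * k)) *\<^sub>R p
          + T *\<^sub>R (R *\<^sub>R e - p) + (\<epsilon> - \<eta> - T * R) *\<^sub>R e \<in> C"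
        using lower T0 p Rp e TR \<eta> \<epsilon> \<delta> k by (intro add scale) auto
      then show ?thesis by (simp add: algebra_simps)
    qed
    then show ?thesis
      using su S(1,3) \<eta>(3)[OF S(2)] unfolding cone_le_def s_def by blast
  qed
qed

theorem proposition1p8:
  fixes C :: "'b::euclidean_space set" and K :: "'a::euclidean_space set"
  assumes "closed C" and "convex_cone C"
    and "closed K" and "convex_cone K"
    and "has_proper_lift C K"
  shows "\<forall>\<epsilon>\<in>{0<..<1}. sp C \<epsilon> \<le> sp K \<epsilon>"
proof
  fix \<epsilon> :: real assume \<epsilon>: "\<epsilon> \<in> {0<..<1}"
  show "sp C \<epsilon> \<le> sp K \<epsilon>"
    unfolding sp_def
  \<comment> \<open>An infimum over a larger set is smaller. For real infima this also needs a
    member of the smaller set, here the constant dimension bound, and a lower bound on the larger,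
    here 0.\<close>
  proof (rule cINF_superset_mono)
    show "{\<alpha>. sparsification_function K \<alpha>} \<noteq> {}"
      using sparsification_function_DIM[OF assms(4)] by blast
    show "bdd_below ((\<lambda>\<alpha>. \<alpha> \<epsilon>) ` {\<alpha>. sparsification_function C \<alpha>})"
      using sparsification_function_nonneg[OF assms(2)] \<epsilon> by (intro bdd_belowI[of _ 0]) auto
    show "{\<alpha>. sparsification_function K \<alpha>} \<subseteq> {\<alpha>. sparsification_function C \<alpha>}"
      using sparsification_function_proper_lift[OF assms(1,2,4,5)] by blast
  qed simp
qed

end
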